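(* Let $\Phi=(A;\{E_i\}_{i=0}^d;A^*;\{E^*_i\}_{i=0}^d)$ be a sharp tridiagonal system on $V$ with eigenvalue sequence $\{\theta_i\}_{i=0}^d$, dual eigenvalue sequence $\{\theta^*_i\}_{i=0}^d$ and split sequence $\{\zeta_i\}_{i=0}^d$. Let $\{\zeta^*_i\}_{i=0}^d$ denote the split sequence of the (sharp) tridiagonal system $\Phi^*=(A^*;\{E^*_i\}_{i=0}^d;A;\{E_i\}_{i=0}^d)$. Then for $0\le i\le d$ both $$(A^*-\theta^*_1I)(A^*-\theta^*_2I)\cdots(A^*-\theta^*_iI)\,\tau_i(A)E^*_0=\zeta_iE^*_0,$$ $$(A-\theta_1I)(A-\theta_2I)\cdots(A-\theta_iI)\,\tau^*_i(A^* )E_0=\zeta_iE_0.$$ Moreover $\zeta_i=\zeta^*_i$ for $0\le i\le d$.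
   Context: $\mathbb{K}$ is a field and $V$ is a $\mathbb{K}$-vector space of finite positive dimension; $\mathrm{End}(V)$ is the algebra of $\mathbb{K}$-linear maps $V\to V$, with identity $I$. "Diagonalizable" means $V$ is spanned by the eigenspaces. A tridiagonal pair on $V$ is an ordered pair $A,A^*\in\mathrm{End}(V)$ ($A^*$ is just a name, not an adjoint) such that: (i) each of $A,A^*$ is diagonalizable; (ii) there is an ordering $\{V_i\}_{i=0}^d$ of the eigenspaces of $A$ with $A^*V_i\subseteq V_{i-1}+V_i+V_{i+1}$ for $0\le i\le d$ (where $V_{-1}=V_{d+1}=0$); (iii) there is an ordering $\{V^*_i\}_{i=0}^\delta$ of the eigenspaces of $A^*$ with $AV^*_i\subseteq V^*_{i-1}+V^*_i+V^*_{i+1}$ for $0\le i\le\delta$ (where $V^*_{-1}=V^*_{\delta+1}=0$); (iv) no subspace $W$ with $0\ne W\ne V$ satisfies $AW\subseteq W$ and $A^*W\subseteq W$. Orderings as in (ii), (iii) are called standard. It is known that $d=\delta$ and that $V_i,V_{d-i},V^*_i,V^*_{d-i}$ all have the same dimension for $0\le i\le d$. A tridiagonal system on $V$ is a sequence $\Phi=(A;\{E_i\}_{i=0}^d;A^*;\{E^*_i\}_{i=0}^d)$ where $A,A^*$ is a tridiagonal pair on $V$ and $\{E_i\}$ (resp. $\{E^*_i\}$) are the primitive idempotents (projections onto the eigenspaces along the other eigenspaces) of $A$ (resp. $A^*$), ordered so that the eigenspaces $\{E_iV\}$ (resp. $\{E^*_iV\}$) are in a standard order. $\theta_i$ (resp.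 $\theta^*_i$) is the eigenvalue of $A$ (resp. $A^*$) on $E_iV$ (resp. $E^*_iV$); $\{\theta_i\}$ and $\{\theta_i^*\}$ are the eigenvalue sequence and dual eigenvalue sequence of $\Phi$. $\Phi$ is sharp if $\dim E_0V=1$ (equivalently $\dim E^*_0V=1$). For an indeterminate $\lambda$ and $0\le i\le d$: $\tau_i=(\lambda-\theta_0)(\lambda-\theta_1)\cdots(\lambda-\theta_{i-1})$ and $\tau^*_i=(\lambda-\theta^*_0)(\lambda-\theta^*_1)\cdots(\lambda-\theta^*_{i-1})$. Split sequence: let $U_i=(E^*_0V+\cdots+E^*_iV)\cap(E_iV+\cdots+E_dV)$ for $0\le i\le d$. It is known that $V=U_0+\cdots+U_d$ is a direct sum, $U_0=E_0^*V$, $(A-\theta_iI)U_i\subseteq U_{i+1}$ and $(A^*-\theta^*_iI)U_i\subseteq U_{i-1}$ ($U_{-1}=U_{d+1}=0$). If $\Phi$ is sharp, $\dim U_0=1$ and $U_0$ is invariant under $(A^*-\theta^*_1I)(A^*-\theta^*_2I)\cdots(A^*-\theta^*_iI)(A-\theta_{i-1}I)\cdots(A-\theta_1I)(A-\theta_0I)$; the corresponding eigenvalue is $\zeta_i$, and $\{\zeta_i\}_{i=0}^d$ is the split sequence of $\Phi$. *)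

theory Defs
  imports Complex_Main "HOL-Library.Set_Algebras" "HOL-Computational_Algebra.Polynomial"
begin

(* The locale linear_operators adds nothing to vector_space; extending vector_space itself would
   clash with its global interpretation by real_vector.  V is the whole type 'b. Sums of subspaces are the pointwise sums of Set_Algebras,
   in which 0 is the zero subspace {0}. *)

locale linear_operators = vector_space scale
  for scale :: "'a::field \<Rightarrow> 'b::ab_group_add \<Rightarrow> 'b" (infixr "*s" 75)
begin

definition eigenspace :: "('b \<Rightarrow> 'b) \<Rightarrow> 'a \<Rightarrow> 'b set" where
  "eigenspace A t = {v. A v = t *s v}"

definition eigenspaces :: "('b \<Rightarrow> 'b) \<Rightarrow> 'b set set" where
  "eigenspaces A = {eigenspace A t |t. eigenspace A t \<noteq> {0}}"

definition diagonalizable :: "('b \<Rightarrow> 'b) \<Rightarrow> bool" where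
  "diagonalizable A \<longleftrightarrow> span (\<Union>(eigenspaces A)) = UNIV"

definition standard_ordering ::
    "('b \<Rightarrow> 'b) \<Rightarrow> ('b \<Rightarrow> 'b) \<Rightarrow> nat \<Rightarrow> (nat \<Rightarrow> 'b set) \<Rightarrow> bool" where
  "standard_ordering A B d W \<longleftrightarrow>
     bij_betw W {..d} (eigenspaces A) \<and>
     (\<forall>i\<le>d. B ` W i \<subseteq>
        (if i = 0 then {0} else W (i - 1)) + W i + (if i = d then {0} else W (i + 1)))"

definition tridiagonal_pair :: "('b \<Rightarrow> 'b) \<Rightarrow> ('b \<Rightarrow> 'b) \<Rightarrow> bool" where
  "tridiagonal_pair A As \<longleftrightarrow>
     Vector_Spaces.linear scale scale A \<and> Vector_Spaces.linear scale scale As \<and>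
     diagonalizable A \<and> diagonalizable As \<and>
     (\<exists>d W. standard_ordering A As d W) \<and>
     (\<exists>\<delta> W. standard_ordering As A \<delta> W) \<and>
     \<not> (\<exists>W. subspace W \<and> W \<noteq> {0} \<and> W \<noteq> UNIV \<and> A ` W \<subseteq> W \<and> As ` W \<subseteq> W)"

(* For diagonalizable A: P is the projection onto one eigenspace along the sum of the others. *)
definition primitive_idempotent :: "('b \<Rightarrow> 'b) \<Rightarrow> ('b \<Rightarrow> 'b) \<Rightarrow> bool" where
  "primitive_idempotent A P \<longleftrightarrow>
     Vector_Spaces.linear scale scale P \<and>
     (\<exists>t. eigenspace A t \<noteq> {0} \<and>
        (\<forall>v \<in> eigenspace A t. P v = v) \<and>
        (\<forall>s. s \<noteq> t \<longrightarrow> (\<forall>v \<in> eigenspace A s. P v = 0)))"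

(* Only the values of E and Es at indices up to d matter. *)
definition tridiagonal_system ::
    "nat \<Rightarrow> ('b \<Rightarrow> 'b) \<Rightarrow> (nat \<Rightarrow> 'b \<Rightarrow> 'b) \<Rightarrow> ('b \<Rightarrow> 'b) \<Rightarrow> (nat \<Rightarrow> 'b \<Rightarrow> 'b) \<Rightarrow> bool" where
  "tridiagonal_system d A E As Es \<longleftrightarrow>
     tridiagonal_pair A As \<and>
     bij_betw E {..d} {P. primitive_idempotent A P} \<and>
     bij_betw Es {..d} {P. primitive_idempotent As P} \<and>
     standard_ordering A As d (\<lambda>i. range (E i)) \<and>
     standard_ordering As A d (\<lambda>i. range (Es i))"

definition sharp_tridiagonal_system ::
    "nat \<Rightarrow> ('b \<Rightarrow> 'b) \<Rightarrow> (nat \<Rightarrow> 'b \<Rightarrow> 'b) \<Rightarrow> ('b \<Rightarrow> 'b) \<Rightarrow> (nat \<Rightarrow> 'b \<Rightarrow> 'b) \<Rightarrow> bool" where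
  "sharp_tridiagonal_system d A E As Es \<longleftrightarrow>
     tridiagonal_system d A E As Es \<and> dim (range (E 0)) = 1"

(* The scalar by which T acts on W; meaningful if W is nonzero and T acts on W as a scalar. *)
definition eigenvalue_on :: "('b \<Rightarrow> 'b) \<Rightarrow> 'b set \<Rightarrow> 'a" where
  "eigenvalue_on T W = (THE t. \<forall>w\<in>W. T w = t *s w)"

lemma eigenvalue_on_eqI:
  assumes "\<And>w. w \<in> W \<Longrightarrow> T w = t *s w" and "u \<in> W" and "u \<noteq> 0"
  shows "eigenvalue_on T W = t"
  unfolding eigenvalue_on_def
proof (rule the_equality)
  fix s assume "\<forall>w\<in>W. T w = s *s w"
  then have "s *s u = t *s u" using assms by metis
  then show "s = t" using \<open>u \<noteq> 0\<close> by simp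
qed (use assms in blast)

(* The dual eigenvalue sequence is eigenvalue_seq As Es. *)
definition eigenvalue_seq :: "('b \<Rightarrow> 'b) \<Rightarrow> (nat \<Rightarrow> 'b \<Rightarrow> 'b) \<Rightarrow> nat \<Rightarrow> 'a" where
  "eigenvalue_seq A E i = eigenvalue_on A (range (E i))"

(* The composition (A - t1 I) (A - t2 I) ... (A - tn I) for the list [t1, ..., tn]. *)
definition shift_prod :: "('b \<Rightarrow> 'b) \<Rightarrow> 'a list \<Rightarrow> 'b \<Rightarrow> 'b" where
  "shift_prod A ts = foldr (\<lambda>t T. (\<lambda>v. A v - t *s v) \<circ> T) ts id"

definition poly_op :: "'a poly \<Rightarrow> ('b \<Rightarrow> 'b) \<Rightarrow> 'b \<Rightarrow> 'b" where
  "poly_op p A = (\<lambda>v. \<Sum>k\<le>degree p. coeff p k *s (A ^^ k) v)"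

definition split_component ::
    "nat \<Rightarrow> (nat \<Rightarrow> 'b \<Rightarrow> 'b) \<Rightarrow> (nat \<Rightarrow> 'b \<Rightarrow> 'b) \<Rightarrow> nat \<Rightarrow> 'b set" where
  "split_component d E Es i = (\<Sum>j=0..i. range (Es j)) \<inter> (\<Sum>j=i..d. range (E j))"

definition split_seq ::
    "nat \<Rightarrow> ('b \<Rightarrow> 'b) \<Rightarrow> (nat \<Rightarrow> 'b \<Rightarrow> 'b) \<Rightarrow> ('b \<Rightarrow> 'b) \<Rightarrow> (nat \<Rightarrow> 'b \<Rightarrow> 'b) \<Rightarrow> nat \<Rightarrow> 'a" where
  "split_seq d A E As Es i =
     eigenvalue_on
       (shift_prod As (map (eigenvalue_seq As Es) [1..<Suc i]) \<circ>
        shift_prod A (map (eigenvalue_seq A E) (rev [0..<i])))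
       (split_component d E Es 0)"

end

definition tau_poly :: "(nat \<Rightarrow> 'a::field) \<Rightarrow> nat \<Rightarrow> 'a poly" where
  "tau_poly \<theta> i = (\<Prod>j<i. [:- \<theta> j, 1:])"

end

(* Write B for A*, and V_i, W_i for the eigenspaces of A, B. The sum over i of the spaces
   (W_0 + ... + W_i) \<inter> (V_{i+1} + ... + V_d) is invariant under A and B and proper, so it is zero;
   hence E_0 is injective on W_0, which is therefore a line on which the split operators act by
   scalars. Put \<eta>_i = (x - \<theta>_1)...(x - \<theta>_i), and likewise \<eta>*_i. On W_0,
     E_0 \<eta>*_i(B) \<tau>_i(A) = E_0 B^i \<tau>_i(A) = E_0 \<tau>*_i(B) \<tau>_i(A) = E_0 \<tau>*_i(B) A^i
       = E_0 \<tau>*_i(B) \<eta>_i(A)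
   by the tridiagonal relations, since \<tau>_i(A) maps V into V_i + ... + V_d and \<tau>*_i(B) kills
   W_0 + ... + W_{i-1}. The left side is \<zeta>_i E_0; the right side is \<zeta>*_i E_0, because
   E_0 \<tau>*_i(B) \<eta>_i(A) kills V_1, ..., V_d. *)

theory Submission
  imports Defs
begin

section \<open>Products of shifted operators and polynomials in an operator\<close>

context linear_operators
begin

abbreviation linear_map :: "('b \<Rightarrow> 'b) \<Rightarrow> bool" where
  "linear_map f \<equiv> Vector_Spaces.linear scale scale f"

lemma linear_map_simps:
  assumes "linear_map f"
  shows "f (x + y) = f x + f y" "f (c *s x) = c *s f x" "f 0 = 0" "f (x - y) = f x - f y"
    and "f (sum g S) = (\<Sum>i\<in>S. f (g i))"
proof -
  interpret f: Vector_Spaces.linear scale scale f by (rule assms)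
  show "f (x + y) = f x + f y" "f (c *s x) = c *s f x" "f 0 = 0" "f (x - y) = f x - f y"
    "f (sum g S) = (\<Sum>i\<in>S. f (g i))"
    by (rule f.add f.scale f.zero f.diff f.sum)+
qed

lemma linear_map_id: "linear_map id"
  by unfold_locales (simp_all add: scale_right_distrib)

lemma linear_map_shift:
  assumes "linear_map f"
  shows "linear_map (\<lambda>v. f v - t *s v)"
  by unfold_locales (simp_all add: linear_map_simps[OF assms] algebra_simps scale_right_distrib)

lemma shift_prod_Nil [simp]: "shift_prod f [] v = v"
  by (simp add: shift_prod_def)

lemma shift_prod_Cons [simp]:
  "shift_prod f (t # ts) v = f (shift_prod f ts v) - t *s shift_prod f ts v"
  by (simp add: shift_prod_def)

lemma shift_prod_snoc: "shift_prod f (ts @ [t]) v = shift_prod f ts (f v - t *s v)"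
  by (induction ts) simp_all

lemma linear_map_funpow:
  assumes "linear_map f"
  shows "linear_map (f ^^ n)"
proof (induction n)
  case 0
  show ?case using linear_map_id by (simp add: id_def)
next
  case (Suc n)
  show ?case using Vector_Spaces.linear_compose[OF Suc assms] by (simp only: funpow.simps)
qed

lemma linear_map_shift_prod:
  assumes "linear_map f"
  shows "linear_map (shift_prod f ts)"
proof (induction ts)
  case Nil
  then show ?case using linear_map_id by (simp add: shift_prod_def id_def)
next
  case (Cons t ts)
  have "shift_prod f (t # ts) = (\<lambda>v. f v - t *s v) \<circ> shift_prod f ts"
    by (simp add: shift_prod_def)
  then show ?case
    using Vector_Spaces.linear_compose[OF Cons linear_map_shift[OF assms]] by (simp only:)
qed

lemma shift_prod_eigenvector:
  assumes "linear_map f" "f v = c *s v"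
  shows "shift_prod f ts v = (\<Prod>t\<leftarrow>ts. c - t) *s v"
  using assms(2)
  by (induction ts)
    (simp_all add: linear_map_simps[OF assms(1)] scale_left_diff_distrib algebra_simps)

text \<open>Here \<open>g\<close> plays the part of a left eigenvector of \<open>f\<close>. With
  \<open>g = E 0\<close>, factors in \<open>A\<close> standing right after \<open>E 0\<close> become
  a scalar.\<close>

lemma shift_prod_left_eigenvector:
  assumes "linear_map g" "\<And>v. g (f v) = c *s g v"
  shows "g (shift_prod f ts v) = (\<Prod>t\<leftarrow>ts. c - t) *s g v"
  by (induction ts)
    (simp_all add: linear_map_simps[OF assms(1)] assms(2) scale_left_diff_distrib algebra_simps)

text \<open>Coefficients beyond the degree vanish. A common summation bound allows \<open>p\<close>
  and its multiple by a linear factor to be compared term by term.\<close>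

lemma poly_op_eq_sum:
  assumes "degree p \<le> n"
  shows "poly_op p f v = (\<Sum>k\<le>n. coeff p k *s (f ^^ k) v)"
  unfolding poly_op_def using assms
  by (intro sum.mono_neutral_left) (auto simp: not_le coeff_eq_0)

lemma poly_op_root_factor:
  assumes "linear_map f"
  shows "poly_op ([:- t, 1:] * p) f v = f (poly_op p f v) - t *s poly_op p f v"
proof -
  define n where "n = degree p"
  have deg: "degree ([:- t, 1:] * p) \<le> Suc n"
    using degree_mult_le[of "[:- t, 1:]" p] by (simp add: n_def)
  \<comment> \<open>\<open>pCons 0 p\<close> is the indeterminate times \<open>p\<close>: its
    constant coefficient is 0, and every other term carries one more \<open>f\<close>.\<close>
  have shift: "(\<Sum>k\<le>Suc n. coeff (pCons 0 p) k *s (f ^^ k) v) = f (poly_op p f v)"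
    by (subst sum.atMost_Suc_shift)
      (simp add: poly_op_def n_def linear_map_simps[OF assms])
  have "poly_op ([:- t, 1:] * p) f v =
      (\<Sum>k\<le>Suc n. coeff (pCons 0 p) k *s (f ^^ k) v - t *s (coeff p k *s (f ^^ k) v))"
    unfolding poly_op_eq_sum[OF deg] by (intro sum.cong) (auto simp: algebra_simps)
  also have "\<dots> = f (poly_op p f v) - t *s (\<Sum>k\<le>Suc n. coeff p k *s (f ^^ k) v)"
    by (simp only: sum_subtractf shift scale_sum_right)
  also have "(\<Sum>k\<le>Suc n. coeff p k *s (f ^^ k) v) = poly_op p f v"
    by (rule poly_op_eq_sum[symmetric]) (simp add: n_def)
  finally show ?thesis .
qed

text \<open>In the reversed list the root added at each induction step stands at the head, as the
  outermost factor, which is where \<open>poly_op_root_factor\<close> puts it. This translates the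
  polynomials of the theorem into the products used in the proof.\<close>

lemma poly_op_tau_poly:
  assumes "linear_map f"
  shows "poly_op (tau_poly \<theta> i) f v = shift_prod f (map \<theta> (rev [0..<i])) v"
proof (induction i)
  case 0
  then show ?case by (simp add: tau_poly_def poly_op_def)
next
  case (Suc i)
  have "tau_poly \<theta> (Suc i) = [:- \<theta> i, 1:] * tau_poly \<theta> i"
    by (simp add: tau_poly_def mult.commute)
  then show ?case by (simp only: poly_op_root_factor[OF assms] Suc) simp
qed

end

section \<open>Eigenspace decompositions and their two flags\<close>

locale eigenspace_resolution = linear_operators scale
  for scale :: "'a::field \<Rightarrow> 'b::ab_group_add \<Rightarrow> 'b" (infixr "*s" 75) +
  fixes d :: nat and A :: "'b \<Rightarrow> 'b" and E :: "nat \<Rightarrow> 'b \<Rightarrow> 'b" and \<theta> :: "nat \<Rightarrow> 'a"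
  assumes linear_A: "linear_map A"
    and linear_E: "i \<le> d \<Longrightarrow> linear_map (E i)"
    and sum_E: "(\<Sum>i\<le>d. E i v) = v"
    and E_orthogonal: "\<lbrakk>i \<le> d; j \<le> d; i \<noteq> j\<rbrakk> \<Longrightarrow> E i (E j v) = 0"
    and A_E: "i \<le> d \<Longrightarrow> A (E i v) = \<theta> i *s E i v"
begin

lemmas A_simps = linear_map_simps[OF linear_A]
lemmas E_simps = linear_map_simps[OF linear_E]

text \<open>Inserting the identity as the sum of all \<open>E j\<close> reduces claims about
  \<open>E i (f v)\<close> to the blocks of \<open>f\<close>.\<close>

lemma E_map_eq_sum:
  assumes "i \<le> d" "linear_map f"
  shows "E i (f v) = (\<Sum>j\<le>d. E i (f (E j v)))"
proof -
  have "E i (f v) = E i (f (\<Sum>j\<le>d. E j v))" by (simp add: sum_E)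
  then show ?thesis using assms by (simp add: linear_map_simps(5)[OF assms(2)] E_simps)
qed

lemma E_idem:
  assumes "i \<le> d"
  shows "E i (E i v) = E i v"
proof -
  have "E i v = (\<Sum>j\<le>d. E j (E i v))" by (simp add: sum_E)
  also have "\<dots> = (\<Sum>j\<le>d. if j = i then E i (E i v) else 0)"
    using assms by (intro sum.cong) (auto simp: E_orthogonal)
  finally show ?thesis using assms by simp
qed

lemma E_A:
  assumes "i \<le> d"
  shows "E i (A v) = \<theta> i *s E i v"
proof -
  have "E i (A v) = (\<Sum>j\<le>d. if j = i then \<theta> i *s E i v else 0)"
    using assms
    by (subst E_map_eq_sum[OF assms linear_A], intro sum.cong) (auto simp: A_E E_simps E_orthogonal E_idem)
  then show ?thesis using assms by simp
qed

lemma eq_0_if_E_eq_0: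
  assumes "\<And>i. i \<le> d \<Longrightarrow> E i v = 0"
  shows "v = 0"
  using assms sum_E[of v] by simp

(* V_n + ... + V_d *)
definition upper :: "nat \<Rightarrow> 'b set" where
  "upper n = {v. \<forall>i\<le>d. i < n \<longrightarrow> E i v = 0}"

(* V_0 + ... + V_n *)
definition lower :: "nat \<Rightarrow> 'b set" where
  "lower n = {v. \<forall>i\<le>d. n < i \<longrightarrow> E i v = 0}"

lemma subspace_upper: "subspace (upper n)"
  by (rule subspaceI) (auto simp: upper_def E_simps)

lemma subspace_lower: "subspace (lower n)"
  by (rule subspaceI) (auto simp: lower_def E_simps)

lemma upper_Suc_imp_upper: "v \<in> upper (Suc n) \<Longrightarrow> v \<in> upper n"
  by (auto simp: upper_def)

lemma lower_imp_lower_Suc: "v \<in> lower n \<Longrightarrow> v \<in> lower (Suc n)"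
  by (auto simp: lower_def)

text \<open>The component at \<open>n\<close> is multiplied by
  \<open>\<theta> n - \<theta> n\<close>; those below it are zero already.\<close>

lemma shift_upper:
  assumes "v \<in> upper n"
  shows "A v - \<theta> n *s v \<in> upper (Suc n)"
  using assms
  by (auto simp: upper_def E_A E_simps less_Suc_eq)

lemma shift_lower:
  assumes "v \<in> lower (Suc n)"
  shows "A v - \<theta> (Suc n) *s v \<in> lower n"
  using assms
  by (auto simp: lower_def E_A E_simps) (metis Suc_lessI)

lemma upper_eq_0: "v \<in> upper (Suc d) \<Longrightarrow> v = 0"
  by (rule eq_0_if_E_eq_0) (auto simp: upper_def)

lemma range_E_iff: "i \<le> d \<Longrightarrow> v \<in> range (E i) \<longleftrightarrow> E i v = v"
  by (auto simp: E_idem intro: range_eqI[OF sym])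

lemma range_E0_eq_lower: "range (E 0) = lower 0"
proof (intro set_eqI iffI)
  fix v assume "v \<in> range (E 0)"
  then show "v \<in> lower 0" by (auto simp: lower_def E_orthogonal)
next
  fix v assume v: "v \<in> lower 0"
  have "(\<Sum>i\<le>d. E i v) = (\<Sum>i\<le>d. if i = 0 then E 0 v else 0)"
    using v by (intro sum.cong) (auto simp: lower_def)
  then show "v \<in> range (E 0)" by (simp add: sum_E range_E_iff)
qed

text \<open>Each eigencomponent of \<open>v\<close> is either zero or killed by the factor belonging
  to its own eigenvalue.\<close>

lemma shift_prod_eq_0:
  assumes "\<And>j. j \<le> d \<Longrightarrow> \<theta> j \<in> set ts \<or> E j v = 0"
  shows "shift_prod A ts v = 0"
proof -
  note linear = linear_map_simps[OF linear_map_shift_prod[OF linear_A]]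
  have "shift_prod A ts v = shift_prod A ts (\<Sum>j\<le>d. E j v)" by (simp only: sum_E)
  also have "\<dots> = (\<Sum>j\<le>d. shift_prod A ts (E j v))" by (rule linear)
  also have "\<dots> = 0"
  proof (rule sum.neutral, clarify)
    fix j assume "j \<le> d"
    then consider "\<theta> j \<in> set ts" | "E j v = 0" using assms by blast
    then show "shift_prod A ts (E j v) = 0"
    proof cases
      case 1
      then have "(\<Prod>t\<leftarrow>ts. \<theta> j - t) = 0" by (force simp: prod_list_zero_iff)
      then show ?thesis
        using shift_prod_eigenvector[OF linear_A A_E[OF \<open>j \<le> d\<close>]] by simp
    qed (simp add: linear)
  qed
  finally show ?thesis .
qed

lemma shift_prod_lower_eq_0:
  assumes "v \<in> lower n"
  shows "shift_prod A (map \<theta> (rev [0..<Suc n])) v = 0"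
proof (rule shift_prod_eq_0)
  fix j assume "j \<le> d"
  show "\<theta> j \<in> set (map \<theta> (rev [0..<Suc n])) \<or> E j v = 0"
  proof (cases "n < j")
    case False
    then have "j \<in> set [0..<Suc n]" by (simp del: upt_Suc)
    then show ?thesis by (simp del: upt_Suc)
  qed (use assms \<open>j \<le> d\<close> in \<open>simp add: lower_def\<close>)
qed

lemma shift_prod_in_upper: "shift_prod A (map \<theta> (rev [0..<n])) v \<in> upper n"
  by (induction n) (auto simp: shift_upper upper_def[of 0])

end

section \<open>Action of a block tridiagonal operator on the flags\<close>

locale tridiagonal_action = eigenspace_resolution scale d A E \<theta>
  for scale :: "'a::field \<Rightarrow> 'b::ab_group_add \<Rightarrow> 'b" (infixr "*s" 75)
    and d A E \<theta> +
  fixes B :: "'b \<Rightarrow> 'b"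
  assumes linear_B: "linear_map B"
    and tridiagonal: "\<lbrakk>i \<le> d; j \<le> d; Suc i < j \<or> Suc j < i\<rbrakk> \<Longrightarrow> E i (B (E j v)) = 0"
begin

lemmas B_simps = linear_map_simps[OF linear_B]

text \<open>A target index \<open>i < n\<close> and a source index \<open>j > n\<close> differ by at
  least 2, so every block that could contribute vanishes.\<close>

lemma B_upper:
  assumes "v \<in> upper (Suc n)"
  shows "B v \<in> upper n"
  unfolding upper_def
proof clarify
  fix i assume "i \<le> d" "i < n"
  have "E i (B (E j v)) = 0" if "j \<le> d" for j
  proof (cases "j < Suc n")
    case True
    then show ?thesis
      using assms that \<open>i \<le> d\<close> by (simp add: upper_def B_simps E_simps)
  next
    case False
    then show ?thesis using that \<open>i \<le> d\<close> \<open>i < n\<close> by (intro tridiagonal) auto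
  qed
  then show "E i (B v) = 0"
    by (subst E_map_eq_sum[OF \<open>i \<le> d\<close> linear_B]) simp
qed

lemma B_lower:
  assumes "v \<in> lower n"
  shows "B v \<in> lower (Suc n)"
  unfolding lower_def
proof clarify
  fix i assume "i \<le> d" "Suc n < i"
  have "E i (B (E j v)) = 0" if "j \<le> d" for j
  proof (cases "n < j")
    case True
    then show ?thesis
      using assms that \<open>i \<le> d\<close> by (simp add: lower_def B_simps E_simps)
  next
    case False
    then show ?thesis using that \<open>i \<le> d\<close> \<open>Suc n < i\<close> by (intro tridiagonal) auto
  qed
  then show "E i (B v) = 0"
    by (subst E_map_eq_sum[OF \<open>i \<le> d\<close> linear_B]) simp
qed

lemma shift_B_upper: "v \<in> upper (Suc n) \<Longrightarrow> B v - t *s v \<in> upper n"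
  by (rule subspace_diff[OF subspace_upper B_upper subspace_scale[OF subspace_upper upper_Suc_imp_upper]])

lemma shift_B_lower: "v \<in> lower n \<Longrightarrow> B v - t *s v \<in> lower (Suc n)"
  by (rule subspace_diff[OF subspace_lower B_lower subspace_scale[OF subspace_lower lower_imp_lower_Suc]])

lemma funpow_B_upper: "v \<in> upper (n + m) \<Longrightarrow> (B ^^ n) v \<in> upper m"
  by (induction n arbitrary: m) (auto intro!: B_upper)

lemma shift_prod_B_upper:
  "v \<in> upper (length ts + m) \<Longrightarrow> shift_prod B ts v \<in> upper m"
  by (induction ts arbitrary: m) (auto intro!: shift_B_upper)

lemma shift_prod_B_lower:
  "v \<in> lower m \<Longrightarrow> shift_prod B ts v \<in> lower (length ts + m)"
  by (induction ts) (auto intro!: shift_B_lower)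

(* Only the leading term of a monic polynomial in B survives. *)
lemma E0_shift_prod_B:
  assumes "v \<in> upper (length ts)"
  shows "E 0 (shift_prod B ts v) = E 0 ((B ^^ length ts) v)"
  using assms
proof (induction ts arbitrary: v rule: rev_induct)
  case (snoc t ts)
  \<comment> \<open>This disposes of the term with \<open>t\<close>: \<open>v\<close> starts at
    level \<open>length ts + 1\<close>, and \<open>length ts\<close> applications of
    \<open>B\<close> are one too few to reach level 0.\<close>
  have "E 0 ((B ^^ length ts) v) = 0"
    using funpow_B_upper[of v "length ts" 1] snoc.prems by (simp add: upper_def)
  moreover have "B v - t *s v \<in> upper (length ts)"
    using snoc.prems by (intro shift_B_upper) simp
  ultimately show ?case
    by (simp add: shift_prod_snoc snoc.IH E_simps
        linear_map_simps[OF linear_map_funpow[OF linear_B]] funpow_Suc_right del: funpow.simps)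
qed simp

text \<open>The leading terms cancel, leaving a polynomial in \<open>B\<close> of degree at most
  \<open>n\<close>, and each \<open>B\<close> climbs at most one level. The length is
  \<open>Suc n\<close> because for the empty product the bound would have index -1.\<close>

lemma shift_prod_B_diff_lower:
  assumes "v \<in> lower 0" "length ts = Suc n"
  shows "shift_prod B ts v - (B ^^ Suc n) v \<in> lower n"
  using assms(2)
proof (induction n arbitrary: ts)
  case 0
  then show ?case using assms(1)
    by (auto simp: length_Suc_conv subspace_neg subspace_lower subspace_scale)
next
  case (Suc n)
  then obtain t ts' where ts: "ts = t # ts'" "length ts' = Suc n"
    by (auto simp: length_Suc_conv)
  have "B (shift_prod B ts' v - (B ^^ Suc n) v) \<in> lower (Suc n)"
    using Suc.IH ts(2) by (intro B_lower)
  moreover have "t *s shift_prod B ts' v \<in> lower (Suc n)"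
    using shift_prod_B_lower[OF assms(1), of ts'] ts(2)
    by (intro subspace_scale subspace_lower) simp
  ultimately have "B (shift_prod B ts' v - (B ^^ Suc n) v) - t *s shift_prod B ts' v \<in> lower (Suc n)"
    by (rule subspace_diff[OF subspace_lower])
  then show ?case
    by (simp add: ts B_simps algebra_simps)
qed

end

section \<open>Irreducibility and the interplay of the two decompositions\<close>

locale tridiagonal_data =
  tridiagonal_action scale d A E \<theta> As +
  dual: tridiagonal_action scale d As Es \<theta>s A
  for scale :: "'a::field \<Rightarrow> 'b::ab_group_add \<Rightarrow> 'b" (infixr "*s" 75)
    and d A E \<theta> As Es \<theta>s +
  assumes irreducible:
      "\<lbrakk>subspace W; A ` W \<subseteq> W; As ` W \<subseteq> W\<rbrakk> \<Longrightarrow> W = {0} \<or> W = UNIV"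
    and E0_nonzero: "\<exists>v. E 0 v \<noteq> 0"
    and Es0_nonzero: "\<exists>v. Es 0 v \<noteq> 0"
begin

text \<open>On the \<open>i\<close>-th intersection, \<open>A - \<theta> (Suc i)\<close> leads to
  the next one and \<open>As - \<theta>s i\<close> to the previous one. The span
  \<open>span G\<close> of all of them is therefore invariant, and irreducibility leaves only zero
  once it is seen to be proper.\<close>

lemma lower_Int_upper:
  assumes "i \<le> d" "v \<in> dual.lower i" "v \<in> upper (Suc i)"
  shows "v = 0"
proof -
  define G where "G = (\<Union>i\<le>d. dual.lower i \<inter> upper (Suc i))"
  have A_G: "A w \<in> span G" if "w \<in> G" for w
  proof -
    obtain i where i: "i \<le> d" "w \<in> dual.lower i" "w \<in> upper (Suc i)"
      using \<open>w \<in> G\<close> unfolding G_def by blast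
    have "A w - \<theta> (Suc i) *s w \<in> span G"
    \<comment> \<open>For \<open>i = d\<close> the index \<open>Suc i\<close> lies beyond the
      eigenvalue sequence, but then \<open>w\<close> is 0 and the value of \<open>\<theta>\<close>
      there is immaterial.\<close>
    proof (cases "i = d")
      case True
      then show ?thesis using i upper_eq_0[of w]
        by (simp add: A_simps span_zero)
    next
      case False
      then have "A w - \<theta> (Suc i) *s w \<in> G"
        using i shift_upper dual.shift_B_lower unfolding G_def
        by (intro UN_I[of "Suc i"]) auto
      then show ?thesis by (rule span_base)
    qed
    then show ?thesis
      using span_add[OF _ span_scale[OF span_base[OF that]], of "A w - \<theta> (Suc i) *s w" "\<theta> (Suc i)"]
      by simp
  qed
  have As_G: "As w \<in> span G" if "w \<in> G" for w
  proof -
    obtain i where i: "i \<le> d" "w \<in> dual.lower i" "w \<in> upper (Suc i)"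
      using \<open>w \<in> G\<close> unfolding G_def by blast
    have "As w - \<theta>s i *s w \<in> span G"
    proof (cases i)
      case 0
      have "Es j (As w - \<theta>s 0 *s w) = 0" if "j \<le> d" for j
        using i(2) that
        by (cases "j = 0") (auto simp: 0 dual.lower_def dual.E_A dual.E_simps)
      then show ?thesis using dual.eq_0_if_E_eq_0 0 by (metis span_zero)
    next
      case (Suc k)
      then have "As w - \<theta>s i *s w \<in> G"
        using i dual.shift_lower shift_B_upper unfolding G_def
        by (intro UN_I[of k]) auto
      then show ?thesis by (rule span_base)
    qed
    then show ?thesis
      using span_add[OF _ span_scale[OF span_base[OF that]], of "As w - \<theta>s i *s w" "\<theta>s i"]
      by simp
  qed
  have invariant: "f ` span G \<subseteq> span G" if "linear_map f" "\<And>w. w \<in> G \<Longrightarrow> f w \<in> span G" for f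
  proof clarify
    fix w assume "w \<in> span G"
    then show "f w \<in> span G"
      by (induction rule: span_induct_alt)
        (auto simp: linear_map_simps[OF that(1)] span_zero intro!: span_add span_scale that(2))
  qed
  \<comment> \<open>\<open>upper 1\<close> is the kernel of \<open>E 0\<close>, which is not the
    whole space.\<close>
  have "G \<subseteq> upper 1" by (auto simp: G_def upper_def)
  then have "span G \<subseteq> upper 1" by (rule span_minimal) (rule subspace_upper)
  then have "span G \<noteq> UNIV" using E0_nonzero by (auto simp: upper_def)
  moreover have "span G = {0} \<or> span G = UNIV"
    by (intro irreducible subspace_span invariant linear_A dual.linear_A A_G As_G)
  ultimately have "span G = {0}" by blast
  moreover have "v \<in> span G" using assms by (intro span_base) (auto simp: G_def)
  ultimately show ?thesis by blast
qed

text \<open>The case \<open>i = 0\<close> of \<open>lower_Int_upper\<close>. It allows vectors of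
  the first dual eigenspace to be compared through their images under \<open>E 0\<close>.\<close>

lemma E0_inj_on_dual:
  assumes "v \<in> range (Es 0)" "E 0 v = 0"
  shows "v = 0"
  using assms by (intro lower_Int_upper[of 0]) (auto simp: dual.range_E0_eq_lower upper_def)

text \<open>The \<open>i\<close> factors in \<open>A\<close> climb at most to level \<open>i\<close>
  of the dual flag; the factors in \<open>As\<close> then strip off the dual levels
  \<open>i\<close>, ..., 1 in turn.\<close>

lemma shift_prod_split:
  assumes "v \<in> range (Es 0)"
  shows "shift_prod As (map \<theta>s [1..<Suc i]) (shift_prod A (map \<theta> (rev [0..<i])) v) \<in> range (Es 0)"
proof -
  have "shift_prod A (map \<theta> (rev [0..<i])) v \<in> dual.lower i"
    using dual.shift_prod_B_lower[of v 0 "map \<theta> (rev [0..<i])"] assms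
    by (simp add: dual.range_E0_eq_lower)
  \<comment> \<open>Naming the vector \<open>x\<close> forgets its origin, so that the induction
    covers all of \<open>dual.lower i\<close>; stripping a factor changes the vector.\<close>
  then have "shift_prod As (map \<theta>s [1..<Suc i]) x \<in> dual.lower 0"
    if "x = shift_prod A (map \<theta> (rev [0..<i])) v" for x
    unfolding that[symmetric]
  proof (induction i arbitrary: x)
    case (Suc i)
    have "shift_prod As (map \<theta>s [1..<Suc i]) (As x - \<theta>s (Suc i) *s x) \<in> dual.lower 0"
      using Suc.prems by (intro Suc.IH dual.shift_lower)
    then show ?case by (simp add: shift_prod_snoc)
  qed simp
  then show ?thesis by (simp add: dual.range_E0_eq_lower)
qed

lemma split_component_0: "split_component d E Es 0 = range (Es 0)"
proof -
  have "v \<in> (\<Sum>j=0..d. range (E j))" for v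
    using sum_E[of v]
    by (auto simp: set_sum_alt atLeast0AtMost intro!: exI[of _ "\<lambda>j. E j v"])
  then show ?thesis by (auto simp: split_component_def)
qed

end

section \<open>Sharpness and the split eigenvalues\<close>

locale sharp_tridiagonal_data = tridiagonal_data +
  assumes sharp: "\<exists>u. \<forall>v. \<exists>c. E 0 v = c *s u"
begin

text \<open>\<open>E 0\<close> maps the first dual eigenspace injectively into a line, so that
  eigenspace is spanned by any of its nonzero vectors.\<close>

lemma dual_sharp: "\<exists>u. \<forall>v. \<exists>c. Es 0 v = c *s u"
proof -
  obtain x where x: "Es 0 x \<noteq> 0" using Es0_nonzero by blast
  obtain u where u: "\<And>v. \<exists>c. E 0 v = c *s u" using sharp by blast
  obtain b where b: "E 0 (Es 0 x) = b *s u" using u by blast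
  have "E 0 (Es 0 x) \<noteq> 0" using E0_inj_on_dual[of "Es 0 x"] x by blast
  then have "b \<noteq> 0" using b by auto
  have "\<exists>c. Es 0 v = c *s Es 0 x" for v
  proof -
    obtain a where a: "E 0 (Es 0 v) = a *s u" using u by blast
    have "Es 0 v - (a / b) *s Es 0 x \<in> range (Es 0)"
      by (rule range_eqI[of _ _ "v - (a / b) *s x"]) (simp add: dual.E_simps)
    moreover have "E 0 (Es 0 v - (a / b) *s Es 0 x) = 0"
      using \<open>b \<noteq> 0\<close> by (simp add: E_simps a b)
    ultimately have "Es 0 v - (a / b) *s Es 0 x = 0" by (rule E0_inj_on_dual)
    then show ?thesis by (intro exI[of _ "a / b"]) simp
  qed
  then show ?thesis by blast
qed

text \<open>The assumptions are symmetric in the two operators except for sharpness, which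
  \<open>dual_sharp\<close> supplies. Every result thus becomes available with the roles
  exchanged.\<close>

lemma dual_sharp_tridiagonal_data: "sharp_tridiagonal_data scale d As Es \<theta>s A E \<theta>"
proof unfold_locales
  show "W = {0} \<or> W = UNIV" if "subspace W" "As ` W \<subseteq> W" "A ` W \<subseteq> W" for W
    using irreducible that by blast
qed (fact E0_nonzero Es0_nonzero dual_sharp)+

definition split_op :: "nat \<Rightarrow> 'b \<Rightarrow> 'b" where
  "split_op i = shift_prod As (map \<theta>s [1..<Suc i]) \<circ> shift_prod A (map \<theta> (rev [0..<i]))"

definition split_eigenvalue :: "nat \<Rightarrow> 'a" where
  "split_eigenvalue i = eigenvalue_on (split_op i) (range (Es 0))"

text \<open>A linear map that preserves a line acts on it as a scalar. The nonzero vector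
  \<open>Es 0 x\<close> makes this scalar unique, hence equal to the one chosen by
  \<open>eigenvalue_on\<close>.\<close>

lemma split_op_Es0:
  shows "split_op i (Es 0 v) = split_eigenvalue i *s Es 0 v"
proof -
  have linear: "linear_map (split_op i)"
    unfolding split_op_def
    using linear_map_shift_prod[OF linear_A] linear_map_shift_prod[OF dual.linear_A]
    by (rule Vector_Spaces.linear_compose)
  obtain x where x: "Es 0 x \<noteq> 0" using Es0_nonzero by blast
  obtain u where u: "\<And>v. \<exists>c. Es 0 v = c *s u" using dual_sharp by blast
  obtain b where b: "Es 0 x = b *s u" using u by blast
  then have "b \<noteq> 0" "u \<noteq> 0" using x by auto
  have "split_op i (Es 0 x) \<in> range (Es 0)"
    unfolding split_op_def using shift_prod_split[of "Es 0 x"] by simp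
  then obtain c where c: "split_op i (Es 0 x) = c *s u" using u by fastforce
  have eigen: "split_op i w = (c / b) *s w" if "w \<in> range (Es 0)" for w
  proof -
    obtain a where a: "w = a *s u" using u \<open>w \<in> range (Es 0)\<close> by fastforce
    then have w: "w = (a / b) *s Es 0 x" using \<open>b \<noteq> 0\<close> by (simp add: b)
    have "split_op i w = (a / b) *s (c *s u)"
      unfolding w by (simp only: linear_map_simps(2)[OF linear] c)
    then show ?thesis by (simp add: a mult.commute)
  qed
  have "split_eigenvalue i = c / b"
    unfolding split_eigenvalue_def using eigen rangeI x by (rule eigenvalue_on_eqI)
  then show ?thesis using eigen by simp
qed

text \<open>Only the component of \<open>v\<close> at 0 contributes on the left: components 1 to
  \<open>i\<close> are killed by the factors in \<open>A\<close>, and from higher ones the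
  \<open>i\<close> factors in \<open>As\<close> cannot descend to level 0. On that component the
  factors in \<open>A\<close> form a scalar, which may be moved to the left of those in
  \<open>As\<close>.\<close>

lemma E0_shift_prod_dual:
  shows "E 0 (shift_prod As (map \<theta>s (rev [0..<i])) (shift_prod A (map \<theta> [1..<Suc i]) v))
    = E 0 (shift_prod A (map \<theta> [1..<Suc i]) (shift_prod As (map \<theta>s (rev [0..<i])) (E 0 v)))"
proof -
  let ?S = "shift_prod As (map \<theta>s (rev [0..<i]))" and ?T = "shift_prod A (map \<theta> [1..<Suc i])"
  note linear = linear_map_simps[OF linear_map_shift_prod[OF linear_A]]
    linear_map_simps[OF linear_map_shift_prod[OF dual.linear_A]] E_simps
  have T: "?T (E k v) = (\<Prod>t\<leftarrow>map \<theta> [1..<Suc i]. \<theta> k - t) *s E k v" if "k \<le> d" for k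
    using that by (intro shift_prod_eigenvector linear_A A_E)
  have "E 0 (?S (?T v)) = E 0 (?S (?T (\<Sum>k\<le>d. E k v)))" by (simp only: sum_E)
  also have "\<dots> = (\<Sum>k\<le>d. E 0 (?S (?T (E k v))))" by (simp only: linear le0)
  also have "\<dots> = (\<Sum>k\<le>d. if k = 0 then E 0 (?S (?T (E 0 v))) else 0)"
  proof (intro sum.cong refl)
    fix k assume "k \<in> {..d}"
    then have k: "k \<le> d" by simp
    consider "k = 0" | "1 \<le> k" "k \<le> i" | "i < k" by linarith
    then show "E 0 (?S (?T (E k v))) = (if k = 0 then E 0 (?S (?T (E 0 v))) else 0)"
    proof cases
      case 2
      then have "?T (E k v) = 0"
      proof (intro shift_prod_eq_0)
        fix j assume "j \<le> d"
        show "\<theta> j \<in> set (map \<theta> [1..<Suc i]) \<or> E j (E k v) = 0"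
          using 2 k \<open>j \<le> d\<close> by (cases "j = k") (auto simp: E_orthogonal simp del: upt_Suc)
      qed
      then show ?thesis using 2 by (simp add: linear)
    next
      case 3
      then have "E k v \<in> upper (length (map \<theta>s (rev [0..<i])) + 1)"
        using k by (auto simp: upper_def E_orthogonal)
      then have "?S (E k v) \<in> upper 1" by (rule shift_prod_B_upper)
      then have "E 0 (?S (E k v)) = 0" by (simp add: upper_def)
      then show ?thesis using 3 by (simp only: T[OF k] linear le0) simp
    qed simp
  qed
  also have "\<dots> = E 0 (?S (?T (E 0 v)))" by simp
  also have "\<dots> = (\<Prod>t\<leftarrow>map \<theta> [1..<Suc i]. \<theta> 0 - t) *s E 0 (?S (E 0 v))"
    by (simp only: T[OF le0] linear le0)
  also have "\<dots> = E 0 (?T (?S (E 0 v)))"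
    by (rule shift_prod_left_eigenvector[symmetric]) (auto simp: linear_E E_A)
  finally show ?thesis .
qed

interpretation dual: sharp_tridiagonal_data scale d As Es \<theta>s A E \<theta>
  by (rule dual_sharp_tridiagonal_data)

text \<open>Both scalars are read off as multiples of the same nonzero vector
  \<open>E 0 v\<close>.\<close>

lemma split_eigenvalue_dual:
  shows "split_eigenvalue i = dual.split_eigenvalue i"
proof -
  obtain x where "Es 0 x \<noteq> 0" using Es0_nonzero by blast
  define v where "v = Es 0 x"
  have v: "v \<in> range (Es 0)" by (simp add: v_def)
  then have "E 0 v \<noteq> 0" using E0_inj_on_dual[of v] \<open>Es 0 x \<noteq> 0\<close> by (auto simp: v_def)
  define \<tau>s where "\<tau>s = map \<theta>s (rev [0..<i])"
  define w where "w = shift_prod A (map \<theta> (rev [0..<i])) v"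
  have w: "w \<in> upper i" unfolding w_def by (rule shift_prod_in_upper)
  have "split_eigenvalue i *s E 0 v = E 0 (split_op i v)"
    by (simp add: v_def split_op_Es0 E_simps)
  also have "\<dots> = E 0 (shift_prod As (map \<theta>s [1..<Suc i]) w)"
    by (simp add: split_op_def w_def)
  \<comment> \<open>As \<open>w\<close> lies in \<open>upper i\<close>, any two monic products of
    \<open>i\<close> factors in \<open>As\<close> agree on it after \<open>E 0\<close>; the power is
    the link between them.\<close>
  also have "\<dots> = E 0 ((As ^^ i) w)"
    using E0_shift_prod_B[of w "map \<theta>s [1..<Suc i]"] w by (simp del: upt_Suc)
  also have "\<dots> = E 0 (shift_prod As \<tau>s w)"
    using E0_shift_prod_B[of w \<tau>s] w by (simp add: \<tau>s_def)
  also have "shift_prod As \<tau>s w = shift_prod As \<tau>s (shift_prod A (map \<theta> [1..<Suc i]) v)"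
  proof (cases i)
    case 0
    then show ?thesis by (simp add: w_def)
  next
    case (Suc n)
    have diff: "shift_prod A ts v - (A ^^ Suc n) v \<in> dual.lower n" if "length ts = Suc n" for ts
      using v that by (intro dual.shift_prod_B_diff_lower) (simp_all add: dual.range_E0_eq_lower)
    \<comment> \<open>Both products have the leading term \<open>A ^^ Suc n\<close>, so they differ
      below dual level \<open>Suc n\<close>, where the factors in \<open>\<tau>s\<close> kill
      everything.\<close>
    have "w - shift_prod A (map \<theta> [1..<Suc i]) v \<in> dual.lower n"
      using subspace_diff[OF dual.subspace_lower diff diff,
          of "map \<theta> (rev [0..<i])" "map \<theta> [1..<Suc i]"]
      by (simp add: Suc w_def)
    then have "shift_prod As \<tau>s (w - shift_prod A (map \<theta> [1..<Suc i]) v) = 0"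
      unfolding \<tau>s_def Suc by (rule dual.shift_prod_lower_eq_0)
    then show ?thesis
      by (simp only: linear_map_simps[OF linear_map_shift_prod[OF dual.linear_A]]) simp
  qed
  also have "E 0 \<dots> = E 0 (dual.split_op i (E 0 v))"
    unfolding \<tau>s_def dual.split_op_def using E0_shift_prod_dual by simp
  also have "\<dots> = dual.split_eigenvalue i *s E 0 v"
    by (simp add: dual.split_op_Es0 E_simps E_idem)
  finally show ?thesis using \<open>E 0 v \<noteq> 0\<close> by simp
qed

lemma split_op_E0:
  shows "shift_prod A (map \<theta> [1..<Suc i]) (shift_prod As (map \<theta>s (rev [0..<i])) (E 0 v))
    = split_eigenvalue i *s E 0 v"
  using dual.split_op_Es0 by (simp add: dual.split_op_def split_eigenvalue_dual)

end

section \<open>From the definition of a sharp tridiagonal system to the locales\<close>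

context linear_operators
begin

lemma eigenspace_resolution_primitive_idempotents:
  assumes "linear_map A" "diagonalizable A"
    and idempotents: "bij_betw E {..d} {P. primitive_idempotent A P}"
    and ranges: "bij_betw (\<lambda>i. range (E i)) {..d} (eigenspaces A)"
  shows "eigenspace_resolution scale d A E (eigenvalue_seq A E)"
    and "i \<le> d \<Longrightarrow> \<exists>v. E i v \<noteq> 0"
proof -
  have E: "primitive_idempotent A (E i)" if "i \<le> d" for i
    using bij_betw_apply[OF idempotents] that by simp
  have eigen: "range (E i) = eigenspace A (eigenvalue_seq A E i) \<and> range (E i) \<noteq> {0} \<and>
      (\<forall>v\<in>range (E i). E i v = v) \<and>
      (\<forall>s. s \<noteq> eigenvalue_seq A E i \<longrightarrow> (\<forall>v\<in>eigenspace A s. E i v = 0))" if i: "i \<le> d" for i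
  proof -
    obtain t where t: "eigenspace A t \<noteq> {0}" "\<forall>v\<in>eigenspace A t. E i v = v"
      "\<forall>s. s \<noteq> t \<longrightarrow> (\<forall>v\<in>eigenspace A s. E i v = 0)"
      using E[OF i] by (auto simp: primitive_idempotent_def)
    obtain s where s: "range (E i) = eigenspace A s"
      using bij_betw_apply[OF ranges, of i] i by (auto simp: eigenspaces_def)
    have "0 \<in> eigenspace A t" using assms(1) by (simp add: eigenspace_def linear_map_simps(3))
    then obtain u where u: "u \<in> eigenspace A t" "u \<noteq> 0" using t(1) by blast
    \<comment> \<open>\<open>E i\<close> fixes \<open>u\<close>, so \<open>u\<close> lies in its
      range. A nonzero vector has only one eigenvalue, so the eigenvalue attached to the idempotent
      is the one of its range.\<close>
    then have "u \<in> eigenspace A s" using t(2) s by (metis rangeI)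
    then have "s = t" using u by (auto simp: eigenspace_def)
    then have "eigenvalue_seq A E i = t"
      unfolding eigenvalue_seq_def s using u
      by (intro eigenvalue_on_eqI) (auto simp: eigenspace_def)
    then show ?thesis using t s \<open>s = t\<close> by simp
  qed
  have linear_E: "linear_map (E i)" if "i \<le> d" for i
    using E[OF that] by (simp add: primitive_idempotent_def)
  have orthogonal: "E i (E j v) = 0" if "i \<le> d" "j \<le> d" "i \<noteq> j" for i j v
  proof -
    \<comment> \<open>The ordering lists each eigenspace once, so different indices carry different
      eigenvalues.\<close>
    have "range (E i) \<noteq> range (E j)"
      using bij_betw_imp_inj_on[OF ranges] that by (auto dest: inj_onD)
    then have "eigenvalue_seq A E j \<noteq> eigenvalue_seq A E i"
      using eigen that by metis
    moreover have "E j v \<in> eigenspace A (eigenvalue_seq A E j)" using eigen[OF that(2)] by blast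
    ultimately show ?thesis using eigen[OF that(1)] by metis
  qed
  have sum_E: "(\<Sum>i\<le>d. E i v) = v" for v
  proof -
    \<comment> \<open>Diagonalizability enters here: it suffices to verify the resolution of the
      identity on eigenvectors.\<close>
    have "v \<in> span (\<Union>(eigenspaces A))" using assms(2) by (simp add: diagonalizable_def)
    then show ?thesis
    proof (induction rule: span_induct_alt)
      case base
      show ?case by (simp add: linear_map_simps(3)[OF linear_E])
    next
      case (step c x y)
      then obtain j where j: "j \<le> d" "x \<in> range (E j)"
        using bij_betw_imp_surj_on[OF ranges] by blast
      have "(\<Sum>i\<le>d. E i x) = (\<Sum>i\<le>d. if i = j then x else 0)"
      proof (intro sum.cong refl)
        fix i assume "i \<in> {..d}"
        moreover obtain y where "x = E j y" using j(2) by blast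
        ultimately show "E i x = (if i = j then x else 0)"
          using eigen[OF j(1)] orthogonal[OF _ j(1)] by (cases "i = j") simp_all
      qed
      then have "(\<Sum>i\<le>d. E i x) = x" using j(1) by simp
      then show ?case
        using step.IH
        by (simp add: linear_map_simps(1,2)[OF linear_E] sum.distrib scale_sum_right[symmetric])
    qed
  qed
  show "eigenspace_resolution scale d A E (eigenvalue_seq A E)"
  proof unfold_locales
    show "A (E i v) = eigenvalue_seq A E i *s E i v" if "i \<le> d" for i v
      using eigen[OF that] by (auto simp: eigenspace_def)
  qed (simp_all add: linear_map_simps(1,2)[OF assms(1)] linear_map_simps(1,2)[OF linear_E]
      sum_E orthogonal)
  show "\<exists>v. E i v \<noteq> 0" if "i \<le> d"
    using eigen[OF that] by (auto simp: image_iff)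
qed

text \<open>The three summands of \<open>B (E j v)\<close> lie in eigenspaces with index within 1 of
  \<open>j\<close>, and \<open>E i\<close> kills each of them when \<open>i\<close> is farther
  away.\<close>

lemma tridiagonal_action_standard_ordering:
  assumes "eigenspace_resolution scale d A E \<theta>" "linear_map B"
    and "standard_ordering A B d (\<lambda>i. range (E i))"
  shows "tridiagonal_action scale d A E \<theta> B"
proof -
  interpret eigenspace_resolution scale d A E \<theta> by (rule assms(1))
  show ?thesis
  proof unfold_locales
    fix i j v assume ij: "i \<le> d" "j \<le> d" "Suc i < j \<or> Suc j < i"
    have "B (E j v) \<in> (if j = 0 then {0} else range (E (j - 1))) + range (E j)
        + (if j = d then {0} else range (E (j + 1)))"
      using assms(3) ij(2) unfolding standard_ordering_def by blast
    then obtain a b c where abc: "B (E j v) = a + b + c"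
      "a \<in> (if j = 0 then {0} else range (E (j - 1)))" "b \<in> range (E j)"
      "c \<in> (if j = d then {0} else range (E (j + 1)))"
      by (elim set_plus_elim) auto
    have "E i a = 0" "E i b = 0" "E i c = 0"
      using abc(2-4) ij by (auto simp: E_simps E_orthogonal split: if_splits)
    then show "E i (B (E j v)) = 0" using ij(1) by (simp add: abc(1) E_simps)
  qed (simp_all add: linear_map_simps[OF assms(2)])
qed

lemma sharp_tridiagonal_data_system:
  assumes "sharp_tridiagonal_system d A E As Es"
  shows "sharp_tridiagonal_data scale d A E (eigenvalue_seq A E) As Es (eigenvalue_seq As Es)"
proof -
  have pair: "tridiagonal_pair A As"
    and E: "bij_betw E {..d} {P. primitive_idempotent A P}"
      "standard_ordering A As d (\<lambda>i. range (E i))"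
    and Es: "bij_betw Es {..d} {P. primitive_idempotent As P}"
      "standard_ordering As A d (\<lambda>i. range (Es i))"
    and dim: "dim (range (E 0)) = 1"
    using assms by (auto simp: sharp_tridiagonal_system_def tridiagonal_system_def)
  have linear: "linear_map A" "linear_map As" and diag: "diagonalizable A" "diagonalizable As"
    using pair by (auto simp: tridiagonal_pair_def)
  have ranges: "bij_betw (\<lambda>i. range (E i)) {..d} (eigenspaces A)"
    "bij_betw (\<lambda>i. range (Es i)) {..d} (eigenspaces As)"
    using E(2) Es(2) by (auto simp: standard_ordering_def)
  note res = eigenspace_resolution_primitive_idempotents[OF linear(1) diag(1) E(1) ranges(1)]
  note dres = eigenspace_resolution_primitive_idempotents[OF linear(2) diag(2) Es(1) ranges(2)]
  interpret tridiagonal_action scale d A E "eigenvalue_seq A E" As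
    using tridiagonal_action_standard_ordering res(1) linear(2) E(2) .
  interpret dual: tridiagonal_action scale d As Es "eigenvalue_seq As Es" A
    using tridiagonal_action_standard_ordering dres(1) linear(1) Es(2) .
  show ?thesis
  proof unfold_locales
    show "W = {0} \<or> W = UNIV" if "subspace W" "A ` W \<subseteq> W" "As ` W \<subseteq> W" for W
      using pair that unfolding tridiagonal_pair_def by blast
    show "\<exists>v. E 0 v \<noteq> 0" "\<exists>v. Es 0 v \<noteq> 0" using res(2) dres(2) by auto
    obtain B where B: "range (E 0) \<subseteq> span B" "card B = 1"
      using basis_exists[of "range (E 0)"] dim by metis
    then obtain u where "B = {u}" by (auto simp: card_1_singleton_iff)
    then have "E 0 v \<in> range (\<lambda>c. c *s u)" for v
      using B(1) by (auto simp: span_singleton)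
    then show "\<exists>u. \<forall>v. \<exists>c. E 0 v = c *s u" by blast
  qed
qed

end

theorem theorem7p3:
  fixes scale :: "'k::field \<Rightarrow> 'v::ab_group_add \<Rightarrow> 'v"
    and Basis :: "'v set"
    and d :: nat
    and A As :: "'v \<Rightarrow> 'v"
    and E Es :: "nat \<Rightarrow> 'v \<Rightarrow> 'v"
    and \<theta> \<theta>s \<zeta> \<zeta>s :: "nat \<Rightarrow> 'k"
  assumes fin_dim: "finite_dimensional_vector_space scale Basis"
    and pos_dim: "vector_space.dim scale (UNIV :: 'v set) > 0"
    and sharp: "linear_operators.sharp_tridiagonal_system scale d A E As Es"
    and theta: "\<And>i. i \<le> d \<Longrightarrow> \<theta> i = linear_operators.eigenvalue_seq scale A E i"
    and thetas: "\<And>i. i \<le> d \<Longrightarrow> \<theta>s i = linear_operators.eigenvalue_seq scale As Es i"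
    and zeta: "\<And>i. i \<le> d \<Longrightarrow> \<zeta> i = linear_operators.split_seq scale d A E As Es i"
    and zetas: "\<And>i. i \<le> d \<Longrightarrow> \<zeta>s i = linear_operators.split_seq scale d As Es A E i"
  shows "\<forall>i\<le>d.
      linear_operators.shift_prod scale As (map \<theta>s [1..<Suc i]) \<circ>
        linear_operators.poly_op scale (tau_poly \<theta> i) A \<circ> Es 0
        = (\<lambda>v. scale (\<zeta> i) (Es 0 v)) \<and>
      linear_operators.shift_prod scale A (map \<theta> [1..<Suc i]) \<circ>
        linear_operators.poly_op scale (tau_poly \<theta>s i) As \<circ> E 0
        = (\<lambda>v. scale (\<zeta> i) (E 0 v)) \<and>
      \<zeta> i = \<zeta>s i"
proof -
  interpret vector_space scale
    using fin_dim by (simp add: finite_dimensional_vector_space_def)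
  interpret linear_operators scale ..
  interpret sharp_tridiagonal_data scale d A E "eigenvalue_seq A E" As Es "eigenvalue_seq As Es"
    by (rule sharp_tridiagonal_data_system[OF sharp])
  interpret dual: sharp_tridiagonal_data scale d As Es "eigenvalue_seq As Es" A E "eigenvalue_seq A E"
    by (rule dual_sharp_tridiagonal_data)
  show ?thesis
  proof (intro allI impI conjI ext)
    fix i v assume i: "i \<le> d"
    \<comment> \<open>The given sequences are fixed only up to \<open>d\<close>; all indices in
      these lists are at most \<open>i\<close>, hence at most \<open>d\<close>.\<close>
    have maps: "map \<theta> [1..<Suc i] = map (eigenvalue_seq A E) [1..<Suc i]"
      "map \<theta>s [1..<Suc i] = map (eigenvalue_seq As Es) [1..<Suc i]"
      "map \<theta> (rev [0..<i]) = map (eigenvalue_seq A E) (rev [0..<i])"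
      "map \<theta>s (rev [0..<i]) = map (eigenvalue_seq As Es) (rev [0..<i])"
      using i by (auto simp del: upt_Suc intro: theta thetas)
    have "split_seq d A E As Es i = split_eigenvalue i"
      unfolding split_seq_def split_eigenvalue_def split_op_def split_component_0 ..
    then have \<zeta>: "\<zeta> i = split_eigenvalue i" by (simp only: zeta[OF i])
    have "split_seq d As Es A E i = dual.split_eigenvalue i"
      unfolding split_seq_def dual.split_eigenvalue_def dual.split_op_def dual.split_component_0 ..
    then show "\<zeta> i = \<zeta>s i"
      by (simp only: zetas[OF i] \<zeta> split_eigenvalue_dual)
    show "(shift_prod As (map \<theta>s [1..<Suc i]) \<circ> poly_op (tau_poly \<theta> i) A \<circ> Es 0) v
        = scale (\<zeta> i) (Es 0 v)"
      using split_op_Es0[of i v]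
      by (simp only: split_op_def o_apply poly_op_tau_poly[OF linear_A] maps \<zeta>)
    show "(shift_prod A (map \<theta> [1..<Suc i]) \<circ> poly_op (tau_poly \<theta>s i) As \<circ> E 0) v
        = scale (\<zeta> i) (E 0 v)"
      using split_op_E0[of i v]
      by (simp only: o_apply poly_op_tau_poly[OF dual.linear_A] maps \<zeta>)
  qed
qed

end
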